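(* Let $(X,d)$ be a metric space and let $f_n:X\to X$, $n\ge 0$, be a sequence of maps, defining the non-autonomous discrete system $x_{n+1}=f_n(x_n)$, $n\ge0$. Let $N\ge 2$ and let $A=(a_{ij})_{N\times N}$ be an irreducible transition matrix with $\sum_{j=1}^{N}a_{i_0j}\ge 2$ for some $1\le i_0\le N$. Let $V_1,\dots,V_N$ be pairwise disjoint nonempty compact subsets of $X$, assume that $\{f_n\}_{n=0}^\infty$ is equi-continuous in $\bigcup_{i=1}^N V_i$, and for each $1\le i\le N$ let $\{V_{i,n}\}_{n=0}^\infty$ be a sequence of nonempty closed subsets of $V_i$. Suppose that (i) the system is weakly $A$-coupled-expanding in $\{V_{i,n}\}_{n=0}^\infty$, $1\le i\le N$; (ii) there exist an integer $1\le j_0\le N$ and a constant $\lambda>1$ such that $a_{j_0j_0}=1$ and $$d(f_n(x),f_n(y))\ge\lambda\, d(x,y)\quad\text{for all } x,y\in V_{j_0,n},\ n\ge0.$$ Then the system $x_{n+1}=f_n(x_n)$, $n\ge0$, is distributionally $\delta$-chaotic for some $\delta>0$.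
   Context: Notation: for $n\ge1$, $f_0^n:=f_{n-1}\circ\cdots\circ f_0$, and $f_0^0$ is the identity. $\{f_n\}$ is equi-continuous in a set $V$ if for every $\epsilon>0$ there is $\eta>0$ such that $d(f_n(x),f_n(y))<\epsilon$ for all $n\ge0$ and all $x,y\in V$ with $d(x,y)<\eta$. A matrix $A=(a_{ij})_{N\times N}$ ($N\ge2$) is a transition matrix if $a_{ij}\in\{0,1\}$ for all $i,j$, $\sum_{j}a_{ij}\ge1$ for all $i$, and $\sum_i a_{ij}\ge1$ for all $j$. It is irreducible if for each pair $1\le i,j\le N$ there is a positive integer $k$ such that the $(i,j)$ entry of $A^k$ is positive. Given sequences $\{V_{i,n}\}_{n\ge0}$, $1\le i\le N$, of nonempty subsets of $X$ with $V_{i,n}\cap V_{j,n}=\partial V_{i,n}\cap\partial V_{j,n}$ for all $i\ne j$ and $n\ge0$ ($\partial$ denotes boundary), the system is weakly $A$-coupled-expanding in $\{V_{i,n}\}_{n=0}^\infty$, $1\le i\le N$, if $f_n(V_{i,n})\supset\bigcup_{j:\,a_{ij}=1}V_{j,n+1}$ for all $1\le i\le N$, $n\ge0$. The system $x_{n+1}=f_n(x_n)$ is distributionally $\delta$-chaotic ($\delta>0$) if there is an uncountable set $D\subset X$ such that for all distinct $x,y\in D$ and every $\epsilon>0$, $$\limsup_{n\to\infty}\frac1n\sum_{j=0}^{n-1}\chi_{[0,\epsilon)}\big(d(f_0^{j}(x),f_0^{j}(y))\big)=1,\qquad \liminf_{n\to\infty}\frac1n\sum_{j=0}^{n-1}\chi_{[0,\delta)}\big(d(f_0^{j}(x),f_0^{j}(y))\big)=0,$$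 where $\chi_{[0,\epsilon)}$ is the characteristic function of $[0,\epsilon)$. *)

theory Defs
  imports "HOL-Analysis.Analysis"
begin

(* The metric space X is the universe of a type of class metric_space, and the index set
   {1,...,N} is the universe of a finite type 'n, so N = CARD('n). *)

primrec nads_iter :: "(nat \<Rightarrow> 'a \<Rightarrow> 'a) \<Rightarrow> nat \<Rightarrow> 'a \<Rightarrow> 'a" where
  "nads_iter f 0 = id"
| "nads_iter f (Suc n) = f n \<circ> nads_iter f n"

(* One eta serves all n and all pairs x, y: equi-continuity is uniform on V. *)
definition equi_continuous_in :: "(nat \<Rightarrow> 'a::metric_space \<Rightarrow> 'a) \<Rightarrow> 'a set \<Rightarrow> bool" where
  "equi_continuous_in f V \<longleftrightarrow>
    (\<forall>\<epsilon>>0. \<exists>\<eta>>0. \<forall>n. \<forall>x\<in>V. \<forall>y\<in>V. dist x y < \<eta> \<longrightarrow> dist (f n x) (f n y) < \<epsilon>)"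

definition transition_matrix :: "nat^'n^'n \<Rightarrow> bool" where
  "transition_matrix A \<longleftrightarrow>
    CARD('n) \<ge> 2 \<and>
    (\<forall>i j. A $ i $ j \<in> {0, 1}) \<and>
    (\<forall>i. (\<Sum>j\<in>UNIV. A $ i $ j) \<ge> 1) \<and>
    (\<forall>j. (\<Sum>i\<in>UNIV. A $ i $ j) \<ge> 1)"

(* The type of square matrices with product ** is no instance of the class power,
   so the power operator ^ is not available for it. *)
primrec matrix_power :: "nat^'n^'n \<Rightarrow> nat \<Rightarrow> nat^'n^'n" where
  "matrix_power A 0 = mat 1"
| "matrix_power A (Suc k) = A ** matrix_power A k"

definition irreducible_matrix :: "nat^'n^'n \<Rightarrow> bool" where
  "irreducible_matrix A \<longleftrightarrow> (\<forall>i j. \<exists>k>0. matrix_power A k $ i $ j > 0)"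

(* The standing requirements on the family V (nonempty sets that meet at most in their
   boundaries) are part of this predicate. *)
definition weakly_coupled_expanding ::
  "nat^'n^'n \<Rightarrow> (nat \<Rightarrow> 'a::metric_space \<Rightarrow> 'a) \<Rightarrow> ('n \<Rightarrow> nat \<Rightarrow> 'a set) \<Rightarrow> bool" where
  "weakly_coupled_expanding A f V \<longleftrightarrow>
    (\<forall>i n. V i n \<noteq> {}) \<and>
    (\<forall>i j n. i \<noteq> j \<longrightarrow> V i n \<inter> V j n = frontier (V i n) \<inter> frontier (V j n)) \<and>
    (\<forall>i n. (\<Union>j\<in>{j. A $ i $ j = 1}. V j (Suc n)) \<subseteq> f n ` V i n)"

(* At n = 0 the value is 0 because of division by zero; only limits as n tends to infinity are used. *)
definition proximity_frequency ::
  "(nat \<Rightarrow> 'a::metric_space \<Rightarrow> 'a) \<Rightarrow> 'a \<Rightarrow> 'a \<Rightarrow> real \<Rightarrow> nat \<Rightarrow> real" where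
  "proximity_frequency f x y r n =
    1 / real n * (\<Sum>j<n. indicator {0..<r} (dist (nads_iter f j x) (nads_iter f j y)))"

(* Limsup and liminf require a complete linear order, hence the embedding into ereal. *)
definition distributionally_chaotic :: "(nat \<Rightarrow> 'a::metric_space \<Rightarrow> 'a) \<Rightarrow> real \<Rightarrow> bool" where
  "distributionally_chaotic f \<delta> \<longleftrightarrow>
    \<delta> > 0 \<and>
    (\<exists>D. uncountable D \<and>
      (\<forall>x\<in>D. \<forall>y\<in>D. x \<noteq> y \<longrightarrow>
        (\<forall>\<epsilon>>0. limsup (\<lambda>n. ereal (proximity_frequency f x y \<epsilon> n)) = 1 \<and>
               liminf (\<lambda>n. ereal (proximity_frequency f x y \<delta> n)) = 0)))"

end

theory Submission
  imports Defs
begin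

text \<open>Irreducibility gives a closed walk \<open>c\<close> through \<open>j0\<close> that uses no loop of the graph of \<open>A\<close>; then
  \<open>c\<close> and its delay by one step disagree at all positive times. Time is cut into phases, each much
  longer than everything before it. In every other phase the itinerary waits at \<open>j0\<close>; in the
  remaining ones it follows \<open>c\<close> or its delay, according to a binary digit. While two orbits wait
  at \<open>j0\<close>, expansion forces them to be exponentially close except near the end of the phase, which
  makes the upper frequency 1. When their digits differ, the orbits lie in different sets \<open>V i\<close>
  throughout the phase, which makes the lower frequency 0 for \<open>\<delta>\<close> the least distance between two
  of these sets.\<close>

section \<open>Symbolic walks\<close>

text \<open>A positive sum of naturals has a positive summand, which supplies the first edge of a
  walk and leaves a positive entry of a smaller power.\<close>

lemma matrix_power_pos_imp_rtrancl:
  assumes "matrix_power A k $ i $ j > 0"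
  shows "(i, j) \<in> {(a, b). A $ a $ b > 0}\<^sup>*"
  using assms
proof (induction k arbitrary: i)
  case 0
  then show ?case
    by (auto simp: mat_def split: if_splits)
next
  case (Suc k)
  have "(\<Sum>l\<in>UNIV. A $ i $ l * matrix_power A k $ l $ j) > 0"
    using Suc.prems by (simp add: matrix_matrix_mult_def)
  then have "(\<Sum>l\<in>UNIV. A $ i $ l * matrix_power A k $ l $ j) \<noteq> 0"
    by (rule gr_implies_not0)
  then obtain l where "A $ i $ l * matrix_power A k $ l $ j \<noteq> 0"
    by (rule sum.not_neutral_contains_not_neutral)
  then have "A $ i $ l > 0" "matrix_power A k $ l $ j > 0"
    by auto
  with Suc.IH show ?case
    by (auto intro: converse_rtrancl_into_rtrancl)
qed

text \<open>Removing the loops from a walk that leaves \<^term>\<open>j0\<close> and comes back.\<close>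

lemma irreducible_loopless_periodic_walk:
  fixes A :: "nat^'n^'n" and j0 :: 'n
  assumes A: "transition_matrix A" "irreducible_matrix A"
  obtains c p where "p > 0" "c 0 = j0" "\<And>n. c (n + p) = c n"
    "\<And>n. A $ c n $ c (Suc n) = 1" "\<And>n. c n \<noteq> c (Suc n)"
proof -
  define R where "R = {(a, b). A $ a $ b > 0}"
  have R: "(i, j) \<in> (R - Id)\<^sup>*" for i j
    using A(2) matrix_power_pos_imp_rtrancl[of A _ i j]
    unfolding irreducible_matrix_def R_def rtrancl_r_diff_Id by blast
  have "\<exists>i. i \<noteq> j0"
  proof (rule ccontr)
    assume "\<nexists>i. i \<noteq> j0"
    then have "UNIV = {j0}" by auto
    then have "CARD('n) = 1" by (metis card_1_singleton_iff One_nat_def)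
    then show False using A(1) by (simp add: transition_matrix_def)
  qed
  then obtain i where "i \<noteq> j0" by blast
  \<comment> \<open>The detour through \<open>i \<noteq> j0\<close> keeps the closed walk from being
    empty once loops are removed.\<close>
  then have "(j0, j0) \<in> (R - Id)\<^sup>+"
    using R[of j0 i] R[of i j0] by (metis rtranclD trancl_trans)
  then obtain p where p: "p > 0" "(j0, j0) \<in> (R - Id) ^^ p"
    by (auto simp: trancl_power)
  then obtain g where g: "g 0 = j0" "g p = j0" "\<And>i. i < p \<Longrightarrow> (g i, g (Suc i)) \<in> R - Id"
    unfolding relpow_fun_conv by blast
  have step: "(g (n mod p), g (Suc n mod p)) \<in> R - Id" for n
  proof -
    \<comment> \<open>When \<open>Suc (n mod p) = p\<close> the index wraps to 0, and
      \<open>g p = g 0\<close> absorbs this.\<close>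
    have "g (Suc n mod p) = g (Suc (n mod p))"
      using g(1,2) by (simp add: mod_Suc)
    then show ?thesis using g(3)[of "n mod p"] p(1) by simp
  qed
  have "A $ a $ b = 1 \<and> a \<noteq> b" if "(a, b) \<in> R - Id" for a b
  proof -
    have "A $ a $ b \<in> {0, 1}" using A(1) unfolding transition_matrix_def by blast
    then show ?thesis using that by (auto simp: R_def)
  qed
  with step p g show ?thesis
    by (intro that[of p "\<lambda>n. g (n mod p)"]) auto
qed

section \<open>Phases of time and the modes used in them\<close>

context
  fixes t :: "nat \<Rightarrow> nat"
  assumes t: "strict_mono t"
begin

text \<open>Phase \<open>Suc k\<close> is the interval \<open>t k < n \<le> t (Suc k)\<close>: a
  breakpoint belongs to the phase that it ends.\<close>

definition phase :: "nat \<Rightarrow> nat" where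
  "phase n = (LEAST k. n \<le> t k)"

lemma phase_le: "n \<le> t (phase n)"
  unfolding phase_def using strict_mono_imp_increasing[OF t] by (rule LeastI)

lemma phase_eq_Suc: "phase n = Suc k" if "t k < n" "n \<le> t (Suc k)"
  unfolding phase_def
proof (rule Least_equality)
  show "Suc k \<le> y" if "n \<le> t y" for y
    using \<open>t k < n\<close> that strict_mono_leD[OF t, of y k] by (metis leD le_trans not_less_eq_eq)
qed (use that in simp)

lemma phase_Suc: "phase (Suc n) = (if n = t (phase n) then Suc (phase n) else phase n)"
proof (cases "n = t (phase n)")
  case True
  then have "phase (Suc n) = Suc (phase n)"
    using strict_monoD[OF t, of "phase n" "Suc (phase n)"]
    by (intro phase_eq_Suc) auto
  with True show ?thesis by simp
next
  case False
  then have "Suc n \<le> t (phase n)"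
    using phase_le[of n] by simp
  moreover have "phase n \<le> k" if "Suc n \<le> t k" for k
    unfolding phase_def using that by (intro Least_le) simp
  ultimately have "phase (Suc n) = phase n"
    unfolding phase_def[of "Suc n"] by (rule Least_equality)
  with False show ?thesis by simp
qed

end

text \<open>A mode is a change of time for the walk \<open>c\<close>: wait at \<open>c 0\<close>,
  follow \<open>c\<close>, or follow \<open>c\<close> one step late. At \<open>n = 0\<close>
  truncated subtraction puts the delayed walk at \<open>c 0\<close> too.\<close>

fun mode_index :: "bool option \<Rightarrow> nat \<Rightarrow> nat" where
  "mode_index None n = 0"
| "mode_index (Some True) n = n"
| "mode_index (Some False) n = n - 1"

text \<open>A delayed phase ends one step before the base point \<^term>\<open>c 0\<close>, so it cannot be followed
  by an undelayed one; hence the condition on consecutive modes.\<close>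

lemma mode_walk_admissible:
  assumes t: "strict_mono t" and dvd: "\<And>k. p dvd t k"
    and mode: "\<And>k. mode k = None \<or> mode (Suc k) = None"
    and per: "\<And>n. c (n + p) = c n"
    and walk: "\<And>n. R (c n) (c (Suc n))" and loop: "R (c 0) (c 0)"
  shows "R (c (mode_index (mode (phase t n)) n)) (c (mode_index (mode (phase t (Suc n))) (Suc n)))"
proof (cases "n = t (phase t n)")
  case True
  \<comment> \<open>Modes change only at breakpoints; these are multiples of the period, so there
    the undelayed walk is at \<open>c 0\<close>.\<close>
  have mult: "c (p * m) = c 0" for m
  proof (induction m)
    case (Suc m)
    then show ?case using per[of "p * m"] by (simp add: add.commute)
  qed simp
  from True dvd[of "phase t n"] obtain m where m: "n = p * m" by (metis dvdE)
  have [simp]: "c n = c 0" using mult m by simp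
  have "R (c n) (c (Suc n))" using walk by blast
  have to_base: "R (c (n - 1)) (c 0)"
  proof (cases n)
    case (Suc k)
    then show ?thesis using walk[of k] \<open>c n = c 0\<close> by simp
  qed (simp add: loop)
  have "R (c 0) (c (Suc n))" using walk[of n] by simp
  moreover have "phase t (Suc n) = Suc (phase t n)"
    using phase_Suc[OF t, of n] True by simp
  ultimately show ?thesis
    using mode[of "phase t n"] to_base loop
    by (cases "(mode (phase t n), n)" rule: mode_index.cases;
        cases "(mode (Suc (phase t n)), Suc n)" rule: mode_index.cases) auto
next
  case False
  then have "phase t (Suc n) = phase t n"
    using phase_Suc[OF t, of n] by simp
  \<comment> \<open>The mode persists, so one step of \<open>c\<close> suffices. Waiting, and the
    delayed walk at \<open>n = 0\<close>, use the loop at \<open>c 0\<close>.\<close>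
  then show ?thesis
    using walk[of n] walk[of "n - 1"] loop
    by (cases "(mode (phase t n), n)" rule: mode_index.cases; cases n) auto
qed

section \<open>Orbits with a prescribed itinerary\<close>

lemma equi_continuous_in_imp_continuous_on:
  assumes "equi_continuous_in f V"
  shows "continuous_on V (f n)"
  unfolding continuous_on_iff
proof (intro ballI allI impI)
  fix x and e :: real assume x: "x \<in> V" and "e > 0"
  then obtain \<eta> where "\<eta> > 0" "\<forall>n. \<forall>x\<in>V. \<forall>y\<in>V. dist x y < \<eta> \<longrightarrow> dist (f n x) (f n y) < e"
    using assms unfolding equi_continuous_in_def by blast
  with x show "\<exists>d>0. \<forall>x'\<in>V. dist x' x < d \<longrightarrow> dist (f n x') (f n x) < e"
    by blast
qed

text \<open>The points that obey the itinerary up to time \<open>n\<close> form nested closed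
  subsets of the compact \<open>K 0\<close>. Lifting points back along \<open>cover\<close> shows
  them nonempty, so they have a common point.\<close>

lemma nads_orbit_in_compacts:
  fixes K :: "nat \<Rightarrow> 'a::metric_space set"
  assumes ne: "\<And>n. K n \<noteq> {}" and comp: "\<And>n. compact (K n)"
    and cont: "\<And>n. continuous_on (K n) (f n)"
    and cover: "\<And>n. K (Suc n) \<subseteq> f n ` K n"
  obtains x where "\<And>n. nads_iter f n x \<in> K n"
proof -
  define C where "C n = {x. \<forall>k\<le>n. nads_iter f k x \<in> K k}" for n
  have C_0: "C 0 = K 0" by (auto simp: C_def)
  have C_Suc: "C (Suc n) = C n \<inter> nads_iter f (Suc n) -` K (Suc n)" for n
    by (auto simp: C_def le_Suc_eq)
  \<comment> \<open>Each \<open>f n\<close> is continuous only on \<open>K n\<close>; continuity of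
    the iterate on \<open>C n\<close> and closedness of the next set therefore feed each
    other.\<close>
  have *: "closed (C n) \<and> continuous_on (C n) (nads_iter f n)" for n
  proof (induction n)
    case 0
    show ?case using comp[of 0] by (simp add: C_def compact_imp_closed continuous_on_id)
  next
    case (Suc n)
    have "nads_iter f n ` C n \<subseteq> K n" by (auto simp: C_def)
    then have "continuous_on (C n) (nads_iter f (Suc n))"
      using Suc cont[of n] unfolding nads_iter.simps
      by (intro continuous_on_compose) (auto intro: continuous_on_subset)
    moreover from this have "closed (C (Suc n))"
      unfolding C_Suc using Suc comp[of "Suc n"]
      by (intro continuous_closed_preimage) (auto intro: compact_imp_closed)
    ultimately show ?case
      by (auto intro: continuous_on_subset simp: C_Suc)
  qed
  have "K n \<subseteq> nads_iter f n ` C n" for n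
  proof (induction n)
    case 0
    show ?case by (auto simp: C_def)
  next
    case (Suc n)
    show ?case
    proof
      fix y assume y: "y \<in> K (Suc n)"
      then obtain z where z: "z \<in> K n" "y = f n z" using cover[of n] by blast
      with Suc obtain x where "x \<in> C n" "z = nads_iter f n x" by blast
      with z y show "y \<in> nads_iter f (Suc n) ` C (Suc n)"
        by (auto simp: C_Suc)
    qed
  qed
  then have C_ne: "C n \<noteq> {}" for n
    using ne[of n] by blast
  have mono: "C n \<subseteq> C m" if "m \<le> n" for m n
    using that by (auto simp: C_def)
  have "C 0 \<inter> (\<Inter>n. C n) \<noteq> {}"
  proof (rule compact_imp_fip_image)
    fix I' :: "nat set" assume "finite I'" "I' \<subseteq> UNIV"
    \<comment> \<open>\<open>insert 0\<close> takes care of the empty subfamily.\<close>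
    then have "C (Max (insert 0 I')) \<subseteq> C 0 \<inter> (\<Inter>n\<in>I'. C n)"
      by (intro Int_greatest INT_greatest mono Max_ge) auto
    with C_ne show "C 0 \<inter> (\<Inter>n\<in>I'. C n) \<noteq> {}" by blast
  qed (use * comp[of 0] in \<open>auto simp: C_0\<close>)
  then show ?thesis using that by (auto simp: C_def)
qed

section \<open>Proximity frequencies\<close>

lemma proximity_frequency_eq_card:
  "proximity_frequency f x y r n =
    real (card {j. j < n \<and> dist (nads_iter f j x) (nads_iter f j y) < r}) / real n"
proof -
  have "(\<Sum>j<n. indicator {0..<r} (dist (nads_iter f j x) (nads_iter f j y))) =
      (\<Sum>j<n. if dist (nads_iter f j x) (nads_iter f j y) < r then 1 else 0 :: real)"
    by (intro sum.cong) (auto simp: indicator_def)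
  also have "\<dots> = real (card ({..<n} \<inter> {j. dist (nads_iter f j x) (nads_iter f j y) < r}))"
    by (simp add: sum.If_cases)
  also have "{..<n} \<inter> {j. dist (nads_iter f j x) (nads_iter f j y) < r} =
      {j. j < n \<and> dist (nads_iter f j x) (nads_iter f j y) < r}"
    by auto
  finally show ?thesis by (simp add: proximity_frequency_def)
qed

lemma liminf_eq_0I:
  fixes u :: "nat \<Rightarrow> real"
  assumes nn: "\<And>n. u n \<ge> 0" and freq: "\<And>\<eta>. \<eta> > 0 \<Longrightarrow> \<exists>\<^sub>F n in sequentially. u n < \<eta>"
  shows "liminf (\<lambda>n. ereal (u n)) = 0"
proof (rule antisym)
  show "liminf (\<lambda>n. ereal (u n)) \<ge> 0"
    using nn by (intro Liminf_bounded) auto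
  show "liminf (\<lambda>n. ereal (u n)) \<le> 0"
  proof (rule ccontr)
    assume "\<not> ?thesis"
    then obtain \<eta> where \<eta>: "0 < ereal \<eta>" "ereal \<eta> < liminf (\<lambda>n. ereal (u n))"
      using ereal_dense2 by (metis not_le)
    have "\<forall>\<^sub>F n in sequentially. \<not> u n < \<eta>"
      using less_LiminfD[OF \<eta>(2)] by eventually_elim simp
    with freq[of \<eta>] \<eta>(1) show False by (simp add: frequently_def)
  qed
qed

lemma limsup_eq_1I:
  fixes u :: "nat \<Rightarrow> real"
  assumes le: "\<And>n. u n \<le> 1" and freq: "\<And>\<eta>. \<eta> > 0 \<Longrightarrow> \<exists>\<^sub>F n in sequentially. u n > 1 - \<eta>"
  shows "limsup (\<lambda>n. ereal (u n)) = 1"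
proof (rule antisym)
  show "limsup (\<lambda>n. ereal (u n)) \<le> 1"
    using le by (intro Limsup_bounded) auto
  show "limsup (\<lambda>n. ereal (u n)) \<ge> 1"
  proof (rule ccontr)
    assume "\<not> ?thesis"
    then obtain b where b: "limsup (\<lambda>n. ereal (u n)) < ereal b" "ereal b < 1"
      using ereal_dense2 by (metis not_le)
    have "\<forall>\<^sub>F n in sequentially. \<not> u n > 1 - (1 - b)"
      using Limsup_lessD[OF b(1)] by eventually_elim simp
    with freq[of "1 - b"] b(2) show False by (simp add: frequently_def)
  qed
qed


lemma proximity_frequency_nonneg: "proximity_frequency f x y r n \<ge> 0"
  by (simp add: proximity_frequency_eq_card)

lemma proximity_frequency_le_1: "proximity_frequency f x y r n \<le> 1"
proof -
  have "card {j. j < n \<and> dist (nads_iter f j x) (nads_iter f j y) < r} \<le> card {..<n}"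
    by (intro card_mono) auto
  then show ?thesis by (cases "n = 0") (simp_all add: proximity_frequency_eq_card)
qed

text \<open>Only the \<open>a + 1\<close> times up to \<open>a\<close> can count.\<close>

lemma proximity_frequency_le_if_apart:
  assumes "\<And>j. a < j \<Longrightarrow> j < n \<Longrightarrow> dist (nads_iter f j x) (nads_iter f j y) \<ge> r"
  shows "proximity_frequency f x y r n \<le> (real a + 1) / real n"
proof -
  have "card {j. j < n \<and> dist (nads_iter f j x) (nads_iter f j y) < r} \<le> card {..a}"
    using assms by (intro card_mono) (auto simp: not_less[symmetric])
  then show ?thesis
    unfolding proximity_frequency_eq_card by (intro divide_right_mono) auto
qed

text \<open>At most the first \<open>a + 1\<close> and the last \<open>q\<close> times fail to
  count.\<close>

lemma proximity_frequency_ge_if_close: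
  assumes "\<And>j. a < j \<Longrightarrow> j + q < n \<Longrightarrow> dist (nads_iter f j x) (nads_iter f j y) < r" and "n > 0"
  shows "proximity_frequency f x y r n \<ge> 1 - (real a + 1 + real q) / real n"
proof -
  have "card {a<..<n - q} \<le> card {j. j < n \<and> dist (nads_iter f j x) (nads_iter f j y) < r}"
    using assms(1) by (intro card_mono) auto
  then have "real n - (real a + 1 + real q)
      \<le> real (card {j. j < n \<and> dist (nads_iter f j x) (nads_iter f j y) < r})"
    by simp
  then have "(real n - (real a + 1 + real q)) / real n \<le> proximity_frequency f x y r n"
    unfolding proximity_frequency_eq_card by (intro divide_right_mono) auto
  with \<open>n > 0\<close> show ?thesis by (simp add: diff_divide_distrib)
qed

text \<open>Used backwards in time: a bound on the distance \<open>m\<close> steps later, divided by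
  \<open>lam ^ m\<close>, bounds the present distance.\<close>

lemma nads_expanding_iterate:
  assumes "\<And>n x y. x \<in> K n \<Longrightarrow> y \<in> K n \<Longrightarrow> dist (f n x) (f n y) \<ge> lam * dist x y" and "lam \<ge> 0"
    and "\<And>i. i < m \<Longrightarrow> nads_iter f (n + i) x \<in> K (n + i)"
    and "\<And>i. i < m \<Longrightarrow> nads_iter f (n + i) y \<in> K (n + i)"
  shows "lam ^ m * dist (nads_iter f n x) (nads_iter f n y)
    \<le> dist (nads_iter f (n + m) x) (nads_iter f (n + m) y)"
  using assms(3,4)
proof (induction m)
  case 0
  then show ?case by simp
next
  case (Suc m)
  have "lam ^ Suc m * dist (nads_iter f n x) (nads_iter f n y)
      \<le> lam * dist (nads_iter f (n + m) x) (nads_iter f (n + m) y)"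
    using Suc \<open>lam \<ge> 0\<close> by (simp add: mult.assoc mult_left_mono)
  also have "\<dots> \<le> dist (nads_iter f (n + Suc m) x) (nads_iter f (n + Suc m) y)"
    using assms(1)[of _ "n + m"] Suc.prems by simp
  finally show ?case .
qed

text \<open>On each product of two distinct members the distance attains a positive minimum;
  finitely many pairs allow a common bound.\<close>

lemma disjoint_compacts_separated:
  fixes V :: "'n::finite \<Rightarrow> 'a::metric_space set"
  assumes comp: "\<And>i. compact (V i)" and disj: "\<And>i j. i \<noteq> j \<Longrightarrow> V i \<inter> V j = {}"
  shows "\<exists>\<delta>>0. \<forall>i j. i \<noteq> j \<longrightarrow> (\<forall>x\<in>V i. \<forall>y\<in>V j. \<delta> \<le> dist x y)"
proof -
  have "\<exists>d>0. i \<noteq> j \<longrightarrow> (\<forall>x\<in>V i. \<forall>y\<in>V j. d \<le> dist x y)" for i j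
  proof (cases "i \<noteq> j \<and> V i \<times> V j \<noteq> {}")
    case True
    have "compact (V i \<times> V j)" using comp by (intro compact_Times)
    then obtain z where z: "z \<in> V i \<times> V j"
      "\<And>u. u \<in> V i \<times> V j \<Longrightarrow> dist (fst z) (snd z) \<le> dist (fst u) (snd u)"
      using True continuous_attains_inf[of "V i \<times> V j" "\<lambda>u. dist (fst u) (snd u)"]
        continuous_on_dist[OF continuous_on_fst[OF continuous_on_id] continuous_on_snd[OF continuous_on_id]]
      by blast
    then have "dist (fst z) (snd z) > 0"
      using disj[of i j] True by (auto simp: mem_Times_iff)
    with z(2) show ?thesis by (intro exI[of _ "dist (fst z) (snd z)"]) auto
  qed (auto intro: exI[of _ 1])
  then obtain d where d: "\<And>i j. d i j > 0"
    "\<And>i j x y. i \<noteq> j \<Longrightarrow> x \<in> V i \<Longrightarrow> y \<in> V j \<Longrightarrow> d i j \<le> dist x y"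
    by metis
  show ?thesis
  proof (intro exI conjI allI impI ballI)
    show "Min (range (\<lambda>(i, j). d i j)) > 0" using d(1) by auto
    fix i j x y assume "i \<noteq> j" "x \<in> V i" "y \<in> V j"
    then have "d i j \<le> dist x y" by (rule d(2))
    moreover have "Min (range (\<lambda>(i, j). d i j)) \<le> d i j"
      by (intro Min_le) (auto intro: rev_image_eqI[of "(i, j)"])
    ultimately show "Min (range (\<lambda>(i, j). d i j)) \<le> dist x y" by simp
  qed
qed

section \<open>Binary codes and the growth of phases\<close>

lemma uncountable_UNIV_nat_bool: "uncountable (UNIV :: (nat \<Rightarrow> bool) set)"
proof -
  have "range F \<noteq> UNIV" for F :: "nat \<Rightarrow> nat \<Rightarrow> bool"
  proof
    assume "range F = UNIV"
    \<comment> \<open>Cantor's diagonal sequence, contradictory at index \<open>n\<close>.\<close>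
    then obtain n where "F n = (\<lambda>i. \<not> F i i)" by (metis rangeE UNIV_I)
    then show False by (metis)
  qed
  then show ?thesis by (simp add: uncountable_def)
qed

text \<open>With breakpoints \<open>p * fact (Suc k)\<close>, all time before a phase, plus a
  constant, is negligible against the end of the phase.\<close>

lemma fact_ratio_tendsto_0:
  assumes "p > 0"
  shows "(\<lambda>k. (real (p * fact (Suc k)) + a) / real (p * fact (Suc (Suc k)))) \<longlonglongrightarrow> 0"
proof (rule Lim_null_comparison)
  show "(\<lambda>k. (1 + \<bar>a\<bar>) / real (Suc (Suc k))) \<longlonglongrightarrow> 0"
    by (intro LIMSEQ_Suc lim_const_over_n)
  show "\<forall>\<^sub>F k in sequentially. norm ((real (p * fact (Suc k)) + a) / real (p * fact (Suc (Suc k))))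
      \<le> (1 + \<bar>a\<bar>) / real (Suc (Suc k))"
  proof (intro always_eventually allI)
    fix k
    define T where "T = real (p * fact (Suc k))"
    have "p * fact (Suc k) \<ge> 1" using assms fact_ge_1[of "Suc k", where ?'a = nat] by (simp del: fact_Suc)
    then have "T \<ge> 1" unfolding T_def by linarith
    have eq: "real (p * fact (Suc (Suc k))) = real (Suc (Suc k)) * T"
      by (simp add: T_def algebra_simps)
    have "\<bar>T + a\<bar> \<le> T + \<bar>a\<bar> * T"
      using \<open>T \<ge> 1\<close> mult_left_mono[of 1 T "\<bar>a\<bar>"] by linarith
    then have "\<bar>T + a\<bar> / (real (Suc (Suc k)) * T) \<le> ((1 + \<bar>a\<bar>) * T) / (real (Suc (Suc k)) * T)"
      using \<open>T \<ge> 1\<close> by (intro divide_right_mono) (auto simp: algebra_simps)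
    also have "\<dots> = (1 + \<bar>a\<bar>) / real (Suc (Suc k))"
      using \<open>T \<ge> 1\<close> by simp
    finally show "norm ((real (p * fact (Suc k)) + a) / real (p * fact (Suc (Suc k))))
        \<le> (1 + \<bar>a\<bar>) / real (Suc (Suc k))"
      using \<open>T \<ge> 1\<close> unfolding eq T_def[symmetric] by (simp add: abs_mult)
  qed
qed

text \<open>Every coordinate of \<^term>\<open>w\<close> is read in infinitely many odd phases, so distinct \<^term>\<open>w\<close> have
  infinitely many phases with distinct modes.\<close>

definition coded_mode :: "(nat \<Rightarrow> bool) \<Rightarrow> nat \<Rightarrow> bool option" where
  "coded_mode w k = (if even k then None else Some (w (fst (prod_decode (k div 2)))))"

lemma coded_mode_differs_frequently:
  assumes "w \<noteq> w'"
  obtains k where "k \<ge> m" "coded_mode w (Suc k) \<noteq> coded_mode w' (Suc k)"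
proof -
  from assms obtain i where "w i \<noteq> w' i" by blast
  \<comment> \<open>The first component selects the digit \<open>i\<close>, the second pushes the
    index beyond \<open>m\<close>; doubling makes its successor an odd phase.\<close>
  moreover have "2 * prod_encode (i, m) \<ge> m"
    using le_prod_encode_2[of m i] by linarith
  ultimately show ?thesis
    by (intro that[of "2 * prod_encode (i, m)"]) (auto simp: coded_mode_def)
qed

theorem corollary4p2:
  fixes f :: "nat \<Rightarrow> 'a::metric_space \<Rightarrow> 'a"
    and A :: "nat^'n^'n"
    and i0 j0 :: 'n
    and V :: "'n \<Rightarrow> 'a set"
    and W :: "'n \<Rightarrow> nat \<Rightarrow> 'a set"
    and lam :: real
  assumes "transition_matrix A"
    and "irreducible_matrix A"
    and "(\<Sum>j\<in>UNIV. A $ i0 $ j) \<ge> 2"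
    and "\<And>i. V i \<noteq> {}"
    and "\<And>i. compact (V i)"
    and "\<And>i j. i \<noteq> j \<Longrightarrow> V i \<inter> V j = {}"
    and "equi_continuous_in f (\<Union>i. V i)"
    and "\<And>i n. W i n \<noteq> {}"
    and "\<And>i n. closed (W i n)"
    and "\<And>i n. W i n \<subseteq> V i"
    and "weakly_coupled_expanding A f W"
    and "A $ j0 $ j0 = 1"
    and "lam > 1"
    and "\<And>n x y. x \<in> W j0 n \<Longrightarrow> y \<in> W j0 n \<Longrightarrow> dist (f n x) (f n y) \<ge> lam * dist x y"
  shows "\<exists>\<delta>>0. distributionally_chaotic f \<delta>"
proof -
  obtain c p where p: "p > 0" and c0: "c 0 = j0" and per: "\<And>n. c (n + p) = c n"
    and walk: "\<And>n. A $ c n $ c (Suc n) = 1" and noloop: "\<And>n. c n \<noteq> c (Suc n)"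
    using irreducible_loopless_periodic_walk[OF assms(1,2)] by metis
  \<comment> \<open>The factor \<open>p\<close> makes switches happen at \<open>c 0\<close>, the
    factorial makes phases dominate the past, and \<open>Suc\<close> avoids
    \<open>fact 0 = fact 1\<close>.\<close>
  define t :: "nat \<Rightarrow> nat" where "t k = p * fact (Suc k)" for k
  have t: "strict_mono t"
    unfolding t_def using p by (intro strict_monoI_Suc mult_strict_left_mono fact_less_mono_nat) auto
  have ratio: "(\<lambda>k. (real (t k) + a) / real (t (Suc k))) \<longlonglongrightarrow> 0" for a
    unfolding t_def by (rule fact_ratio_tendsto_0[OF p])
  have t_ge: "k \<le> t (Suc k)" for k
    using strict_mono_imp_increasing[OF t, of "Suc k"] by simp
  define s where "s w n = c (mode_index (coded_mode w (phase t n)) n)" for w n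
  have adm: "A $ s w n $ s w (Suc n) = 1" for w n
    unfolding s_def
    by (rule mode_walk_admissible[OF t, where p = p and R = "\<lambda>i j. A $ i $ j = 1"])
      (use per walk c0 assms(12) in \<open>auto simp: t_def coded_mode_def\<close>)
  \<comment> \<open>For odd \<open>k\<close> the phase \<open>Suc k\<close> is even, hence a waiting
    phase.\<close>
  have s_j0: "s w n = j0" if "t k < n" "n \<le> t (Suc k)" "odd k" for w n k
    using that by (simp add: s_def phase_eq_Suc[OF t] coded_mode_def c0)
  \<comment> \<open>Distinct modes occur only in odd phases, where one itinerary is at
    \<open>c n\<close> and the other at \<open>c (n - 1)\<close>.\<close>
  have s_differ: "s w n \<noteq> s w' n"
    if "coded_mode w (Suc k) \<noteq> coded_mode w' (Suc k)" "t k < n" "n \<le> t (Suc k)" for w w' n k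
  proof -
    have "n > 0" using that by simp
    then have "c n \<noteq> c (n - 1)" using noloop[of "n - 1"] by simp
    with that show ?thesis
      by (auto simp: s_def phase_eq_Suc[OF t] coded_mode_def split: if_splits)
  qed
  have "\<exists>x. \<forall>n. nads_iter f n x \<in> W (s w n) n" for w
  proof -
    have "compact (W i n)" for i n
      using assms(5)[of i] assms(9,10)[of i n] by (metis compact_Int_closed inf.absorb2)
    moreover have "continuous_on (W i n) (f n)" for i n
      by (rule continuous_on_subset[OF equi_continuous_in_imp_continuous_on[OF assms(7)]])
        (use assms(10)[of i n] in auto)
    moreover have "W (s w (Suc n)) (Suc n) \<subseteq> f n ` W (s w n) n" for n
      using assms(11) adm[of w n] unfolding weakly_coupled_expanding_def by blast
    ultimately show ?thesis
      using nads_orbit_in_compacts[of "\<lambda>n. W (s w n) n" f] assms(8) by metis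
  qed
  then obtain X where X: "\<And>w n. nads_iter f n (X w) \<in> W (s w n) n" by metis
  obtain \<delta> where \<delta>: "\<delta> > 0"
    "\<forall>i j. i \<noteq> j \<longrightarrow> (\<forall>x\<in>V i. \<forall>y\<in>V j. \<delta> \<le> dist x y)"
    using disjoint_compacts_separated[of V, OF assms(5) assms(6)] by blast
  have apart: "dist (nads_iter f n (X w)) (nads_iter f n (X w')) \<ge> \<delta>"
    if "coded_mode w (Suc k) \<noteq> coded_mode w' (Suc k)" "t k < n" "n \<le> t (Suc k)" for w w' n k
    using s_differ[OF that] X[of n w] X[of n w'] assms(10) \<delta>(2) by blast
  \<comment> \<open>A phase with distinct modes contains a time at which the two orbits are at least
    \<open>\<delta>\<close> apart.\<close>
  have inj: "inj X"
  proof (rule injI, rule ccontr)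
    fix w w' assume "X w = X w'" "w \<noteq> w'"
    with apart[of w _ w'] coded_mode_differs_frequently[of w w' 0] \<delta>(1) strict_monoD[OF t]
    show False by (metis dist_self lessI not_le order_refl)
  qed
  have liminf: "liminf (\<lambda>n. ereal (proximity_frequency f (X w) (X w') \<delta> n)) = 0"
    if "w \<noteq> w'" for w w'
  proof (rule liminf_eq_0I[OF proximity_frequency_nonneg])
    fix \<eta> :: real assume "\<eta> > 0"
    then obtain M where M: "\<And>k. k \<ge> M \<Longrightarrow> (real (t k) + 1) / real (t (Suc k)) < \<eta>"
      using order_tendstoD(2)[OF ratio[of 1]] by (auto simp: eventually_sequentially)
    show "\<exists>\<^sub>F n in sequentially. proximity_frequency f (X w) (X w') \<delta> n < \<eta>"
      unfolding frequently_sequentially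
    proof
      fix m
      obtain k where k: "k \<ge> max m M" "coded_mode w (Suc k) \<noteq> coded_mode w' (Suc k)"
        using coded_mode_differs_frequently[OF \<open>w \<noteq> w'\<close>] .
      \<comment> \<open>Measured at the end of a phase with distinct modes, throughout which the
        orbits are apart.\<close>
      have "proximity_frequency f (X w) (X w') \<delta> (t (Suc k)) \<le> (real (t k) + 1) / real (t (Suc k))"
        using apart[OF k(2)] by (intro proximity_frequency_le_if_apart) auto
      also have "\<dots> < \<eta>" using k(1) by (intro M) simp
      finally show "\<exists>n\<ge>m. proximity_frequency f (X w) (X w') \<delta> n < \<eta>"
        using k(1) t_ge[of k] by (intro exI[of _ "t (Suc k)"]) auto
    qed
  qed
  have limsup: "limsup (\<lambda>n. ereal (proximity_frequency f (X w) (X w') \<epsilon> n)) = 1"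
    if "\<epsilon> > 0" for w w' \<epsilon>
  proof (rule limsup_eq_1I[OF proximity_frequency_le_1])
    fix \<eta> :: real assume "\<eta> > 0"
    obtain B where B: "\<And>x y. x \<in> V j0 \<Longrightarrow> y \<in> V j0 \<Longrightarrow> dist x y \<le> B"
      using compact_imp_bounded[OF assms(5)[of j0]] bounded_two_points by metis
    \<comment> \<open>A distance of at least \<open>\<epsilon>\<close> would exceed the bound
      \<open>B\<close> for \<open>V j0\<close> after \<open>q\<close> expanding steps. This
      \<open>q\<close> is the same for all phases.\<close>
    obtain q where q: "B / \<epsilon> < lam ^ q"
      using real_arch_pow[OF assms(13)] by blast
    have close: "dist (nads_iter f j (X w)) (nads_iter f j (X w')) < \<epsilon>"
      if k: "odd k" "t k < j" "j + q < t (Suc k)" for k j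
    proof -
      have in_W: "nads_iter f (j + i) (X v) \<in> W j0 (j + i)" if "i \<le> q" for v i
        using X[of "j + i" v] s_j0[of k "j + i" v] k that by simp
      have "lam ^ q * dist (nads_iter f j (X w)) (nads_iter f j (X w'))
          \<le> dist (nads_iter f (j + q) (X w)) (nads_iter f (j + q) (X w'))"
        by (rule nads_expanding_iterate[where K = "W j0"]) (use assms(13,14) in_W in auto)
      also have "\<dots> \<le> B"
        using in_W[of q] assms(10)[of j0] by (blast intro: B)
      also have "B < lam ^ q * \<epsilon>"
        using q \<open>\<epsilon> > 0\<close> by (simp add: field_simps)
      finally show ?thesis using assms(13) by simp
    qed
    obtain M where M: "\<And>k. k \<ge> M \<Longrightarrow> (real (t k) + (1 + real q)) / real (t (Suc k)) < \<eta>"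
      using order_tendstoD(2)[OF ratio[of "1 + real q"] \<open>\<eta> > 0\<close>] by (auto simp: eventually_sequentially)
    show "\<exists>\<^sub>F n in sequentially. proximity_frequency f (X w) (X w') \<epsilon> n > 1 - \<eta>"
      unfolding frequently_sequentially
    proof
      fix m
      \<comment> \<open>Oddness makes phase \<open>Suc k\<close> a waiting one; its final
        \<open>q\<close> times are the only ones in it not known to be close.\<close>
      define k where "k = 2 * max m M + 1"
      have k: "k \<ge> m" "k \<ge> M" "odd k" by (auto simp: k_def)
      have "1 - \<eta> < 1 - (real (t k) + 1 + real q) / real (t (Suc k))"
        using M[OF k(2)] by (simp add: add.assoc)
      also have "\<dots> \<le> proximity_frequency f (X w) (X w') \<epsilon> (t (Suc k))"
        using close[OF k(3)] p by (intro proximity_frequency_ge_if_close) (auto simp: t_def)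
      finally show "\<exists>n\<ge>m. proximity_frequency f (X w) (X w') \<epsilon> n > 1 - \<eta>"
        using k(1) t_ge[of k] by (intro exI[of _ "t (Suc k)"]) auto
    qed
  qed
  have "uncountable (range X)"
    using uncountable_UNIV_nat_bool inj by (simp add: countable_image_inj_eq)
  then have "distributionally_chaotic f \<delta>"
    unfolding distributionally_chaotic_def using \<delta>(1) liminf limsup
    by (intro conjI exI[of _ "range X"]) (auto intro!: liminf)
  with \<delta>(1) show ?thesis by blast
qed

end
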